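(* Let $1<p<m$. There exists $\sigma_*>0$ such that, for any $\sigma\in(0,\sigma_* )$, any good profile with interface to the equation $$(f^m)''(\xi)-\alpha f(\xi)+\beta\xi f'(\xi)+\xi^{\sigma}f(\xi)^p=0,\qquad \xi\in[0,\infty),$$ with $\alpha=\frac{\sigma+2}{2(p-1)+\sigma(m-1)}$, $\beta=\frac{m-p}{2(p-1)+\sigma(m-1)}$, is of type (P1), that is, satisfies $f(0)=a>0$ and $f'(0)=0$. In particular, the corresponding self-similar solutions $u(x,t)=(T-t)^{-\alpha}f(|x|(T-t)^{\beta})$ to $u_t=(u^m)_{xx}+|x|^{\sigma}u^p$ blow up globally as $t\to T$.
   Context: Solutions $f$ of the differential equation are nonnegative: $f:[0,\infty)\to[0,\infty)$ is continuous, $f^m$ is $C^1$, and the equation holds classically at every $\xi>0$ with $f(\xi)>0$. A solution $f$ is a \emph{good profile} if it fulfills one of the following two properties at $\xi=0$: (P1) $f(0)=a>0$ and $f'(0)=0$; (P2) $f(0)=0$ and $(f^m)'(0)=0$. A good profile $f$ is a \emph{good profile with interface} at a point $\eta\in(0,\infty)$ if $f(\eta)=0$, $(f^m)'(\eta)=0$ and $f>0$ on $(\eta-\delta,\eta)$ for some $\delta>0$. For a solution $u$ with initial condition $u_0=u(\cdot,0)$ and blow up time $T\in(0,\infty)$ (meaning $u(t)\in L^\infty(\mathbb{R})$ for $t\in(0,T)$ and $u(T)\notin L^\infty(\mathbb{R})$), the blow up set is $$B(u_0)=\{x\in\mathbb{R}:\ \exists (x_k,t_k)\in\mathbb{R}\times(0,T),\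 t_k\to T,\ x_k\to x,\ |u(x_k,t_k)|\to\infty \text{ as } k\to\infty\}.$$ Blowing up globally means $B(u_0)=\mathbb{R}$. *)

theory Defs
  imports "HOL-Probability.Probability"
begin

definition C1_on :: "real set \<Rightarrow> (real \<Rightarrow> real) \<Rightarrow> bool" where
  "C1_on S g \<longleftrightarrow> (\<exists>g'. continuous_on S g' \<and>
     (\<forall>x\<in>S. (g has_real_derivative g' x) (at x within S)))"

definition alpha :: "real \<Rightarrow> real \<Rightarrow> real \<Rightarrow> real" where
  "alpha m p \<sigma> = (\<sigma> + 2) / (2 * (p - 1) + \<sigma> * (m - 1))"

definition beta :: "real \<Rightarrow> real \<Rightarrow> real \<Rightarrow> real" where
  "beta m p \<sigma> = (m - p) / (2 * (p - 1) + \<sigma> * (m - 1))"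

text \<open>
  Profiles live on \<open>[0,\<infinity>)\<close>; their values at negative arguments are irrelevant, so
  derivatives at \<open>0\<close> are one-sided. The equation is required only where \<open>f > 0\<close>.
\<close>

definition profile_solution :: "real \<Rightarrow> real \<Rightarrow> real \<Rightarrow> (real \<Rightarrow> real) \<Rightarrow> bool" where
  "profile_solution m p \<sigma> f \<longleftrightarrow>
     (\<forall>\<xi>\<ge>0. 0 \<le> f \<xi>) \<and>
     continuous_on {0..} f \<and>
     C1_on {0..} (\<lambda>\<xi>. f \<xi> powr m) \<and>
     (\<forall>\<xi>>0. f \<xi> > 0 \<longrightarrow>
        (\<exists>f1 w2. (f has_real_derivative f1) (at \<xi>) \<and>
           (deriv (\<lambda>y. f y powr m) has_real_derivative w2) (at \<xi>) \<and>
           w2 - alpha m p \<sigma> * f \<xi> + beta m p \<sigma> * \<xi> * f1 + \<xi> powr \<sigma> * f \<xi> powr p = 0))"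

definition type_P1 :: "(real \<Rightarrow> real) \<Rightarrow> bool" where
  "type_P1 f \<longleftrightarrow> f 0 > 0 \<and> (f has_real_derivative 0) (at 0 within {0..})"

definition type_P2 :: "real \<Rightarrow> (real \<Rightarrow> real) \<Rightarrow> bool" where
  "type_P2 m f \<longleftrightarrow>
     f 0 = 0 \<and> ((\<lambda>\<xi>. f \<xi> powr m) has_real_derivative 0) (at 0 within {0..})"

definition good_profile :: "real \<Rightarrow> real \<Rightarrow> real \<Rightarrow> (real \<Rightarrow> real) \<Rightarrow> bool" where
  "good_profile m p \<sigma> f \<longleftrightarrow> profile_solution m p \<sigma> f \<and> (type_P1 f \<or> type_P2 m f)"

definition interface_at :: "real \<Rightarrow> (real \<Rightarrow> real) \<Rightarrow> real \<Rightarrow> bool" where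
  "interface_at m f \<eta> \<longleftrightarrow>
     0 < \<eta> \<and> f \<eta> = 0 \<and> ((\<lambda>\<xi>. f \<xi> powr m) has_real_derivative 0) (at \<eta>) \<and>
     (\<exists>\<delta>>0. \<forall>\<xi>\<in>{\<eta> - \<delta><..<\<eta>}. f \<xi> > 0)"

definition good_profile_with_interface ::
    "real \<Rightarrow> real \<Rightarrow> real \<Rightarrow> (real \<Rightarrow> real) \<Rightarrow> bool" where
  "good_profile_with_interface m p \<sigma> f \<longleftrightarrow>
     good_profile m p \<sigma> f \<and> (\<exists>\<eta>. interface_at m f \<eta>)"

text \<open>Functions of space and time are written \<open>u x t\<close>.\<close>

definition self_similar ::
    "real \<Rightarrow> real \<Rightarrow> real \<Rightarrow> real \<Rightarrow> (real \<Rightarrow> real) \<Rightarrow> real \<Rightarrow> real \<Rightarrow> real" where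
  "self_similar m p \<sigma> T f x t =
     (T - t) powr (- alpha m p \<sigma>) * f (\<bar>x\<bar> * (T - t) powr beta m p \<sigma>)"

text \<open>
  The notion of solution of \<open>u\<^sub>t = (u\<^sup>m)\<^sub>x\<^sub>x + |x|\<^sup>\<sigma> u\<^sup>p\<close> on \<open>\<real> \<times> (0,T)\<close> matching that of
  the profiles: \<open>u\<close> is continuous and nonnegative, \<open>u\<^sup>m\<close> is \<open>C\<^sup>1\<close> in space, and the
  equation holds classically wherever \<open>u > 0\<close>.
\<close>

definition pde_solution ::
    "real \<Rightarrow> real \<Rightarrow> real \<Rightarrow> real \<Rightarrow> (real \<Rightarrow> real \<Rightarrow> real) \<Rightarrow> bool" where
  "pde_solution m p \<sigma> T u \<longleftrightarrow>
     (\<forall>x. \<forall>t\<in>{0..<T}. 0 \<le> u x t) \<and>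
     continuous_on (UNIV \<times> {0..<T}) (\<lambda>(x, t). u x t) \<and>
     (\<forall>t\<in>{0..<T}. C1_on UNIV (\<lambda>x. u x t powr m)) \<and>
     (\<forall>x. \<forall>t\<in>{0<..<T}. u x t > 0 \<longrightarrow>
        (\<exists>ut w2. ((\<lambda>s. u x s) has_real_derivative ut) (at t) \<and>
           (deriv (\<lambda>y. u y t powr m) has_real_derivative w2) (at x) \<and>
           ut = w2 + \<bar>x\<bar> powr \<sigma> * u x t powr p))"

definition Linf_norm :: "(real \<Rightarrow> real) \<Rightarrow> ereal" where
  "Linf_norm g = esssup lborel (\<lambda>x. ereal \<bar>g x\<bar>)"

definition in_Linf :: "(real \<Rightarrow> real) \<Rightarrow> bool" where
  "in_Linf g \<longleftrightarrow> g \<in> borel_measurable lborel \<and> Linf_norm g < \<infinity>"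

text \<open>
  Since \<open>u\<close> has no real-valued trace at time \<open>T\<close>, the condition \<open>u(T) \<notin> L\<^sup>\<infinity>\<close> is read as
  divergence of the \<open>L\<^sup>\<infinity>\<close> norm as \<open>t\<close> increases to \<open>T\<close>.
\<close>

definition blow_up_time :: "(real \<Rightarrow> real \<Rightarrow> real) \<Rightarrow> real \<Rightarrow> bool" where
  "blow_up_time u T \<longleftrightarrow>
     0 < T \<and> (\<forall>t\<in>{0<..<T}. in_Linf (\<lambda>x. u x t)) \<and>
     ((\<lambda>t. Linf_norm (\<lambda>x. u x t)) \<longlongrightarrow> \<infinity>) (at_left T)"

definition blow_up_set :: "(real \<Rightarrow> real \<Rightarrow> real) \<Rightarrow> real \<Rightarrow> real set" where
  "blow_up_set u T =
     {x. \<exists>(X :: nat \<Rightarrow> real) \<tau>. (\<forall>k. \<tau> k \<in> {0<..<T}) \<and>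
        \<tau> \<longlonglongrightarrow> T \<and> X \<longlonglongrightarrow> x \<and>
        filterlim (\<lambda>k. \<bar>u (X k) (\<tau> k)\<bar>) at_top sequentially}"

definition blows_up_globally :: "(real \<Rightarrow> real \<Rightarrow> real) \<Rightarrow> real \<Rightarrow> bool" where
  "blows_up_globally u T \<longleftrightarrow> blow_up_time u T \<and> blow_up_set u T = UNIV"

end

theory Submission
  imports Defs "HOL-Real_Asymp.Real_Asymp"
begin

text \<open>
  Write \<open>w = f\<^sup>m\<close>. For \<open>\<sigma> = 0\<close> there is a one-line reason why a profile of type (P2) has no
  interface: multiplying the equation by \<open>w'\<close> shows that the energy
  \<open>w'\<^sup>2 / 2 - \<alpha> m / (m + 1) f\<^sup>m\<^sup>+\<^sup>1 + m / (m + p) f\<^sup>m\<^sup>+\<^sup>p\<close> has derivative \<open>- \<beta> \<xi> f' w' \<le> 0\<close>,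
  not identically zero, whereas it vanishes both at \<open>0\<close> and at the interface. For \<open>\<sigma> > 0\<close> the weight \<open>\<xi>\<^sup>\<sigma>\<close> spoils the sign.
  It is restored by the Pohozaev-type multiplier \<open>\<xi>\<^sup>k w' + C \<xi>\<^sup>k\<^sup>-\<^sup>1 w\<close> with a small \<open>k > 0\<close>,
  where \<open>C = m (k + \<sigma>) / (m + p)\<close> is exactly the constant for which the reaction terms cancel.
  With \<open>k\<close> fixed and \<open>\<sigma>\<close> small compared with \<open>k\<close> the term in \<open>f\<^sup>m\<^sup>+\<^sup>1\<close> gets the good sign. The price
  is a term in \<open>w'\<^sup>2\<close> of size \<open>k\<close> with the wrong sign, and the friction \<open>\<beta> \<xi> f' w'\<close> absorbs it as
  soon as \<open>f\<^sup>m\<^sup>-\<^sup>1 \<le> K \<xi>\<^sup>2\<close> with \<open>K / \<beta>\<close> bounded uniformly in small \<open>\<sigma>\<close>.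
  The functional is then strictly decreasing on \<open>(0, \<eta>)\<close> with equal values at both ends, which is
  absurd (\<open>pohozaev_obstruction\<close>); \<open>pohozaev_weight_exists\<close> chooses \<open>k\<close> and \<open>\<sigma>\<^sub>0\<close>.

  The growth bound (\<open>self_similar_bound\<close>) comes from the once integrated equation: where \<open>f \<le> M\<close>,
  \<open>w' + \<beta> \<xi> f \<le> (\<alpha> + \<beta>) M \<xi>\<close> because the reaction only helps (\<open>flux_bound\<close>). Integrating again up to
  a point where \<open>f\<close> attains its maximum \<open>M\<close> gives \<open>M\<^sup>m\<^sup>-\<^sup>1 \<le> (\<alpha> + \<beta>) \<xi>\<^sup>2 / 2\<close>.
  The same inequality started at a zero \<open>a > 0\<close> of \<open>f\<close> makes \<open>w'\<close> negative at a maximum just to the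
  right of \<open>a\<close>, so \<open>f\<close> stays zero after its first positive zero (\<open>no_revival\<close>). In particular a
  profile with interface has compact support and is bounded.

  For the self-similar solution, the only point where the differential equation is not a mere change
  of variables is \<open>x = 0\<close>: there \<open>\<xi> f'\<close> tends to \<open>0\<close>, so the even extension of \<open>w\<close> has second derivative
  \<open>\<alpha> f(0)\<close>. Since \<open>\<beta> > 0\<close>, at a fixed \<open>x\<close> the argument \<open>|x| (T - t)\<^sup>\<beta>\<close> of \<open>f\<close> tends to \<open>0\<close>, and
  \<open>f(0) > 0\<close> lets the factor \<open>(T - t)\<^sup>-\<^sup>\<alpha>\<close> blow up at every \<open>x\<close>.
\<close>

section \<open>The profile equation on the half-line\<close>

text \<open>
  The data of a good profile in a form ready for calculus: \<open>dw\<close> is the derivative of \<open>f\<^sup>m\<close>, continuous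
  up to \<open>0\<close>, and the equation is solved for the second derivative. Both types of good
  profile satisfy \<open>dw 0 = 0\<close>, so everything that does not distinguish them can be done here.
\<close>

locale profile =
  fixes m p \<sigma> :: real and f dw :: "real \<Rightarrow> real"
  assumes p_gt_1: "1 < p" and p_less_m: "p < m" and sigma_pos: "0 < \<sigma>"
    and nonneg: "\<And>x. 0 \<le> x \<Longrightarrow> 0 \<le> f x"
    and cont_f: "continuous_on {0..} f"
    and cont_dw: "continuous_on {0..} dw"
    and w_deriv: "\<And>x. 0 \<le> x \<Longrightarrow>
      ((\<lambda>y. f y powr m) has_real_derivative dw x) (at x within {0..})"
    and f_deriv: "\<And>x. 0 < x \<Longrightarrow> 0 < f x \<Longrightarrow> (f has_real_derivative deriv f x) (at x)"
    and dw_deriv: "\<And>x. 0 < x \<Longrightarrow> 0 < f x \<Longrightarrow> (dw has_real_derivative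
      alpha m p \<sigma> * f x - beta m p \<sigma> * x * deriv f x - x powr \<sigma> * f x powr p) (at x)"
    and dw_0: "dw 0 = 0"

lemma has_real_derivative_within_nonneg:
  fixes x :: real
  assumes "0 < x"
  shows "(g has_real_derivative D) (at x within {0..}) \<longleftrightarrow> (g has_real_derivative D) (at x)"
proof -
  have "at x within {0..} = at x"
    using assms by (intro at_within_interior) (auto simp: interior_real_atLeast)
  then show ?thesis by simp
qed

lemma good_profile_imp_profile:
  assumes "1 < p" "p < m" "0 < \<sigma>" and good: "good_profile m p \<sigma> f"
  obtains dw where "profile m p \<sigma> f dw"
proof -
  let ?w = "\<lambda>y. f y powr m"
  have sol: "profile_solution m p \<sigma> f" and types: "type_P1 f \<or> type_P2 m f"
    using good by (auto simp: good_profile_def)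
  obtain dw where cont: "continuous_on {0..} dw"
    and der: "\<And>x. 0 \<le> x \<Longrightarrow> (?w has_real_derivative dw x) (at x within {0..})"
    using sol by (auto simp: profile_solution_def C1_on_def)
  have deriv_w: "deriv ?w x = dw x" if "0 < x" for x
    using der[of x] that by (auto simp: has_real_derivative_within_nonneg intro: DERIV_imp_deriv)
  have classic_ode: "\<exists>f1 w2. (f has_real_derivative f1) (at x) \<and> (deriv ?w has_real_derivative w2) (at x) \<and>
     w2 - alpha m p \<sigma> * f x + beta m p \<sigma> * x * f1 + x powr \<sigma> * f x powr p = 0"
    if "0 < x" "0 < f x" for x
    using sol that unfolding profile_solution_def by blast
  have ode: "(f has_real_derivative deriv f x) (at x) \<and> (deriv ?w has_real_derivative
      alpha m p \<sigma> * f x - beta m p \<sigma> * x * deriv f x - x powr \<sigma> * f x powr p) (at x)"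
    if x: "0 < x" "0 < f x" for x
  proof -
    obtain f1 w2 where f1: "(f has_real_derivative f1) (at x)"
      and w2: "(deriv ?w has_real_derivative w2) (at x)"
      and eq: "w2 - alpha m p \<sigma> * f x + beta m p \<sigma> * x * f1 + x powr \<sigma> * f x powr p = 0"
      using classic_ode[OF x] by blast
    have "deriv f x = f1"
      using f1 by (rule DERIV_imp_deriv)
    moreover have "w2 = alpha m p \<sigma> * f x - beta m p \<sigma> * x * f1 - x powr \<sigma> * f x powr p"
      using eq by simp
    ultimately show ?thesis
      using f1 w2 by simp
  qed
  have dw2: "(dw has_real_derivative
      alpha m p \<sigma> * f x - beta m p \<sigma> * x * deriv f x - x powr \<sigma> * f x powr p) (at x)"
    if x: "0 < x" "0 < f x" for x
  proof (rule has_field_derivative_transform_within_open[OF conjunct2[OF ode[OF x]]])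
    show "open {0::real<..}" "x \<in> {0<..}" using x by auto
  qed (use deriv_w in auto)
  have "(?w has_real_derivative 0) (at 0 within {0..})"
  proof (cases "type_P1 f")
    case True
    then have *: "(f has_real_derivative 0) (at 0 within {0..})" "0 < f 0"
      by (auto simp: type_P1_def)
    have "(?w has_real_derivative m * f 0 powr (m - 1) * 0) (at 0 within {0..})"
      using DERIV_chain'[OF *(1) has_real_derivative_powr[OF *(2)]] .
    then show ?thesis by simp
  next
    case False
    then show ?thesis using types by (auto simp: type_P2_def)
  qed
  moreover have "at (0::real) within {0..} \<noteq> bot"
    by (simp add: at_within_Ici_at_right)
  ultimately have "dw 0 = 0"
    using der[of 0] has_field_derivative_unique by fastforce
  then have "profile m p \<sigma> f dw"
    using assms(1-3) sol cont der ode dw2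
    by unfold_locales (auto simp: profile_solution_def)
  then show ?thesis by (rule that)
qed

text \<open>
  Negative powers of \<open>\<xi>\<close> multiply \<open>f\<^sup>m\<close> in the functional below; this lemma turns a growth bound
  into continuity up to \<open>0\<close>. Since \<open>0 powr e = 0\<close>, those products vanish at \<open>0\<close>.
\<close>

lemma continuous_on_dominated_at_0:
  fixes h b :: "real \<Rightarrow> real"
  assumes h: "continuous_on {0<..} h" and le: "\<And>x. 0 \<le> x \<Longrightarrow> \<bar>h x\<bar> \<le> b x"
    and b: "continuous_on {0..} b" "b 0 = 0"
  shows "continuous_on {0..} h"
  unfolding continuous_on_def
proof
  fix x :: real assume x: "x \<in> {0..}"
  show "(h \<longlongrightarrow> h x) (at x within {0..})"
  proof (cases "x = 0")
    case True
    have "(b \<longlongrightarrow> 0) (at 0 within {0..})"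
      using b unfolding continuous_on_def by force
    then have "(h \<longlongrightarrow> 0) (at 0 within {0..})"
      by (rule Lim_null_comparison[rotated]) (auto simp: eventually_at_filter le)
    moreover have "h 0 = 0" using le[of 0] b by simp
    ultimately show ?thesis using True by simp
  next
    case False
    then have "isCont h x"
      using h x by (simp add: continuous_on_eq_continuous_at)
    then show ?thesis
      by (simp add: isCont_def tendsto_within_subset[OF _ subset_UNIV])
  qed
qed

lemma continuous_on_x_powr:
  fixes a :: real
  assumes "0 < a"
  shows "continuous_on {0..} (\<lambda>x::real. x powr a)"
  by (rule continuous_on_powr'[OF continuous_on_id continuous_on_const]) (use assms in auto)

context profile
begin

abbreviation "\<alpha> \<equiv> alpha m p \<sigma>"
abbreviation "\<beta> \<equiv> beta m p \<sigma>"

lemma denominator_pos: "0 < 2 * (p - 1) + \<sigma> * (m - 1)"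
  using p_gt_1 p_less_m sigma_pos by (intro add_pos_pos) auto

lemma alpha_pos: "0 < \<alpha>" and beta_pos: "0 < \<beta>"
  using denominator_pos p_less_m sigma_pos by (auto simp: alpha_def beta_def)

lemma w_deriv_at: "0 < x \<Longrightarrow> ((\<lambda>y. f y powr m) has_real_derivative dw x) (at x)"
  using w_deriv[of x] by (simp add: has_real_derivative_within_nonneg)

lemma dw_eq:
  assumes "0 < x" "0 < f x"
  shows "dw x = m * f x powr (m - 1) * deriv f x"
proof (rule DERIV_unique[OF w_deriv_at[OF assms(1)]])
  show "((\<lambda>y. f y powr m) has_real_derivative m * f x powr (m - 1) * deriv f x) (at x)"
    using DERIV_fun_powr[OF f_deriv[OF assms] assms(2), of m] by simp
qed

text \<open>
  A zero of \<open>f\<close> is a minimum of the differentiable function \<open>f\<^sup>m\<close>.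
\<close>

lemma dw_eq_0_at_zero:
  assumes "0 < x" "f x = 0"
  shows "dw x = 0"
proof (rule DERIV_local_min[OF w_deriv_at[OF assms(1)] assms(1)], intro allI impI)
  fix y assume "\<bar>x - y\<bar> < x"
  show "f x powr m \<le> f y powr m" using assms by simp
qed

section \<open>Consequences of the integrated equation\<close>

lemma continuous_on_f_powr:
  assumes "0 < a"
  shows "continuous_on {0..} (\<lambda>x. f x powr a)"
  by (rule continuous_on_powr'[OF cont_f continuous_on_const]) (use assms nonneg in auto)

text \<open>
  The derivative of the left-hand side is \<open>(\<alpha> + \<beta>) f - \<xi>\<^sup>\<sigma> f\<^sup>p \<le> (\<alpha> + \<beta>) M\<close>, and both sides agree at \<open>a\<close>.
  The hypothesis on \<open>a * f a\<close> covers the two starting points needed, the origin and a zero of \<open>f\<close>.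
\<close>

lemma flux_bound:
  assumes a: "0 \<le> a" "a * f a = 0" "dw a = 0"
    and pos: "\<And>s. s \<in> {a<..<b} \<Longrightarrow> 0 < f s"
    and le: "\<And>s. s \<in> {a..b} \<Longrightarrow> f s \<le> M"
    and s: "s \<in> {a..b}"
  shows "dw s + \<beta> * s * f s \<le> (\<alpha> + \<beta>) * M * (s - a)"
proof -
  let ?H = "\<lambda>s. dw s + \<beta> * s * f s - (\<alpha> + \<beta>) * M * (s - a)"
  have "?H s \<le> ?H a"
  proof (rule DERIV_nonpos_imp_decreasing_open[where f = ?H])
    show "a \<le> s" using s by simp
    show "continuous_on {a..s} ?H"
      using a by (intro continuous_intros continuous_on_subset[OF cont_f] continuous_on_subset[OF cont_dw]) auto
    fix x assume x: "a < x" "x < s"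
    have x0: "0 < x" and fx: "0 < f x" and fM: "f x \<le> M"
      using x a s pos[of x] le[of x] by auto
    have "(?H has_real_derivative (\<alpha> * f x - \<beta> * x * deriv f x - x powr \<sigma> * f x powr p)
       + (\<beta> * f x + \<beta> * x * deriv f x) - (\<alpha> + \<beta>) * M) (at x)"
      by (rule derivative_eq_intros dw_deriv f_deriv x0 fx refl | simp add: algebra_simps)+
    moreover have nonneg_reaction: "0 \<le> x powr \<sigma> * f x powr p" by simp
    have "(\<alpha> + \<beta>) * f x \<le> (\<alpha> + \<beta>) * M"
      using alpha_pos beta_pos fM by (intro mult_left_mono) auto
    then have "(\<alpha> * f x - \<beta> * x * deriv f x - x powr \<sigma> * f x powr p)
       + (\<beta> * f x + \<beta> * x * deriv f x) - (\<alpha> + \<beta>) * M \<le> 0"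
      using nonneg_reaction by (simp only: ring_distribs)
    ultimately show "\<exists>y. (?H has_real_derivative y) (at x) \<and> y \<le> 0" by blast
  qed
  then show ?thesis using a by auto
qed

text \<open>
  If \<open>f\<close> were positive right after a zero \<open>a > 0\<close>, then at the maximum \<open>t\<close> of \<open>f\<close> over a short interval
  to the right of \<open>a\<close> the drift term \<open>- \<beta> t f(t)\<close> would dominate the source \<open>(\<alpha> + \<beta>) f(t) (t - a)\<close>,
  so \<open>f\<^sup>m\<close> would be strictly decreasing there and larger values would lie to the left of \<open>t\<close>.
\<close>

lemma no_revival:
  assumes "0 < x" "f x = 0" "x < y"
  shows "f y = 0"
proof (rule ccontr)
  assume "f y \<noteq> 0"
  then have fy: "0 < f y" using nonneg[of y] assms by force
  define Z where "Z = {s \<in> {x..y}. f s = 0}"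
  have "closed Z"
    unfolding Z_def using assms
    by (intro continuous_closed_preimage_constant continuous_on_subset[OF cont_f]) auto
  moreover have "bounded Z"
    by (rule bounded_subset[of "{x..y}"]) (auto simp: Z_def)
  moreover have "x \<in> Z" using assms by (simp add: Z_def)
  then have "Z \<noteq> {}" by blast
  ultimately obtain a where a: "a \<in> Z" and amax: "\<And>s. s \<in> Z \<Longrightarrow> s \<le> a"
    using compact_attains_sup[of Z] by (auto simp: compact_eq_bounded_closed)
  have fa: "f a = 0" and xa: "x \<le> a" and ay: "a < y" and a0: "0 < a"
    using a fy assms by (auto simp: Z_def less_le)
  have pos: "0 < f s" if "a < s" "s \<le> y" for s
    using amax[of s] that xa nonneg[of s] assms by (force simp: Z_def)
  \<comment> \<open>Up to this \<open>d\<close> the source \<open>(\<alpha> + \<beta>) (s - a)\<close> does not exceed the drift \<open>\<beta> a\<close>.\<close>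
  define d where "d = min y (a + \<beta> * a / (\<alpha> + \<beta>))"
  have ad: "a < d" using ay a0 alpha_pos beta_pos by (simp add: d_def)
  have dy: "d \<le> y" by (simp add: d_def)
  have "(\<alpha> + \<beta>) * (d - a) \<le> (\<alpha> + \<beta>) * (\<beta> * a / (\<alpha> + \<beta>))"
    using alpha_pos beta_pos by (intro mult_left_mono) (auto simp: d_def)
  then have small: "(\<alpha> + \<beta>) * (d - a) \<le> \<beta> * a"
    using alpha_pos beta_pos by simp
  have "\<exists>t\<in>{a..d}. \<forall>s\<in>{a..d}. f s \<le> f t"
    using ad a0 by (intro continuous_attains_sup continuous_on_subset[OF cont_f]) auto
  then obtain t where t: "t \<in> {a..d}" and max: "\<And>s. s \<in> {a..d} \<Longrightarrow> f s \<le> f t" by blast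
  have ft: "0 < f t" using max[of d] pos[of d] ad dy by auto
  then have at: "a < t" using fa t by (cases "t = a") auto
  have "dw t + \<beta> * t * f t \<le> (\<alpha> + \<beta>) * f t * (t - a)"
    by (rule flux_bound[where b = d])
      (use fa a0 dw_eq_0_at_zero[of a] pos max t dy in auto)
  also have "\<dots> = f t * ((\<alpha> + \<beta>) * (t - a))" by simp
  also have "\<dots> \<le> f t * (\<beta> * a)"
  proof (rule mult_left_mono)
    have "(\<alpha> + \<beta>) * (t - a) \<le> (\<alpha> + \<beta>) * (d - a)"
      using t alpha_pos beta_pos by (intro mult_left_mono) auto
    with small show "(\<alpha> + \<beta>) * (t - a) \<le> \<beta> * a" by simp
  qed (use ft in simp)
  also have "\<dots> < f t * (\<beta> * t)"
    using ft at beta_pos by simp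
  finally have "dw t < 0" by (simp add: mult_ac)
  then obtain e where e: "0 < e" "\<And>h. 0 < h \<Longrightarrow> h < e \<Longrightarrow> f t powr m < f (t - h) powr m"
    using DERIV_neg_dec_left[OF w_deriv_at, of t] at a0 by auto
  define h where "h = min (e / 2) (t - a)"
  have h: "0 < h" "h < e" "t - h \<in> {a..d}"
    using e at t by (auto simp: h_def)
  have "f (t - h) powr m \<le> f t powr m"
    using max[OF h(3)] nonneg[of "t - h"] h(3) a0 p_gt_1 p_less_m by (intro powr_mono2) auto
  with e(2)[OF h(1,2)] show False by simp
qed

lemma interface_support:
  assumes "interface_at m f \<eta>"
  shows "0 < \<eta>" "f \<eta> = 0" "\<And>x. 0 < x \<Longrightarrow> x < \<eta> \<Longrightarrow> 0 < f x" "\<And>x. \<eta> \<le> x \<Longrightarrow> f x = 0"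
proof -
  show \<eta>: "0 < \<eta>" "f \<eta> = 0" using assms by (auto simp: interface_at_def)
  obtain \<delta> where \<delta>: "0 < \<delta>" "\<And>x. \<eta> - \<delta> < x \<Longrightarrow> x < \<eta> \<Longrightarrow> 0 < f x"
    using assms by (auto simp: interface_at_def)
  show "0 < f x" if x: "0 < x" "x < \<eta>" for x
  proof (rule ccontr)
    assume "\<not> 0 < f x"
    then have "f x = 0" using nonneg[of x] x by simp
    moreover obtain y where "max x (\<eta> - \<delta>) < y" "y < \<eta>"
      using dense[of "max x (\<eta> - \<delta>)" \<eta>] x \<delta>(1) by auto
    ultimately show False
      using no_revival[of x y] x \<delta>(2)[of y] by simp
  qed
  show "f x = 0" if "\<eta> \<le> x" for x
    using no_revival[OF \<eta>, of x] that \<eta>(2) by (cases "x = \<eta>") auto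
qed

lemma bounded_of_interface:
  assumes "interface_at m f \<eta>"
  shows "\<exists>M. \<forall>x\<ge>0. f x \<le> M"
proof -
  note sup = interface_support[OF assms]
  have "\<exists>t\<in>{0..\<eta>}. \<forall>s\<in>{0..\<eta>}. f s \<le> f t"
    using sup(1) by (intro continuous_attains_sup continuous_on_subset[OF cont_f]) auto
  then obtain t where t: "t \<in> {0..\<eta>}" "\<And>s. s \<in> {0..\<eta>} \<Longrightarrow> f s \<le> f t" by blast
  show ?thesis
  proof (intro exI[of _ "f t"] allI impI)
    fix x :: real assume "0 \<le> x"
    then show "f x \<le> f t"
      using t sup(4)[of x] nonneg[of t] by (cases "x \<le> \<eta>") auto
  qed
qed

text \<open>
  The scaling of \<open>w'' = \<alpha> f\<close>. At the point \<open>t\<close> of \<open>[0, x]\<close> where \<open>f\<close> is maximal, integrating the flux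
  bound once more gives \<open>f(t)\<^sup>m \<le> (\<alpha> + \<beta>) f(t) t\<^sup>2 / 2\<close>, and one factor \<open>f(t)\<close> cancels. What matters later
  is that the constant is comparable to \<open>\<beta>\<close> uniformly in small \<open>\<sigma>\<close>.
\<close>

lemma self_similar_bound:
  assumes f0: "f 0 = 0" and x: "0 \<le> x"
  shows "f x powr (m - 1) \<le> (\<alpha> + \<beta>) / 2 * x\<^sup>2"
proof (cases "f x = 0")
  case True
  have "0 \<le> (\<alpha> + \<beta>) / 2 * x\<^sup>2"
    using alpha_pos beta_pos by (intro mult_nonneg_nonneg) auto
  with True show ?thesis by simp
next
  case False
  then have fx: "0 < f x" using nonneg x by force
  then have x0: "0 < x" using x f0 by (cases "x = 0") auto
  have pos: "0 < f s" if "0 < s" "s \<le> x" for s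
  proof (rule ccontr)
    assume "\<not> 0 < f s"
    then have "f s = 0" using nonneg[of s] that by simp
    with no_revival[of s x] that fx show False by (cases "s = x") auto
  qed
  have "\<exists>t\<in>{0..x}. \<forall>s\<in>{0..x}. f s \<le> f t"
    using x by (intro continuous_attains_sup continuous_on_subset[OF cont_f]) auto
  then obtain t where t: "t \<in> {0..x}" and max: "\<And>s. s \<in> {0..x} \<Longrightarrow> f s \<le> f t" by blast
  have ft: "0 < f t" using max[of x] x fx by auto
  then have t0: "0 < t" using f0 t by (cases "t = 0") auto
  let ?V = "\<lambda>s. f s powr m - (\<alpha> + \<beta>) * f t * s\<^sup>2 / 2"
  have "?V t \<le> ?V 0"
  proof (rule DERIV_nonpos_imp_decreasing_open[where f = ?V])
    show "0 \<le> t" using t0 by simp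
    show "continuous_on {0..t} ?V"
      using p_gt_1 p_less_m
      by (intro continuous_on_diff continuous_on_subset[OF continuous_on_f_powr] continuous_intros) auto
    fix s assume s: "0 < s" "s < t"
    have "(?V has_real_derivative dw s - (\<alpha> + \<beta>) * f t * s) (at s)"
      by (rule derivative_eq_intros w_deriv_at s refl | simp)+
    moreover have "dw s + \<beta> * s * f s \<le> (\<alpha> + \<beta>) * f t * (s - 0)"
    proof (rule flux_bound[where b = x])
      show "0 < f s'" if "s' \<in> {0<..<x}" for s' using that by (intro pos) auto
      show "f s' \<le> f t" if "s' \<in> {0..x}" for s' using that by (rule max)
      show "s \<in> {0..x}" using s t by simp
    qed (simp_all add: dw_0)
    then have "dw s - (\<alpha> + \<beta>) * f t * s \<le> 0"
    proof -
      have "0 < \<beta> * s * f s" using s t by (intro mult_pos_pos beta_pos pos) auto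
      then show ?thesis using \<open>dw s + \<beta> * s * f s \<le> _\<close> by simp
    qed
    ultimately show "\<exists>y. (?V has_real_derivative y) (at s) \<and> y \<le> 0" by blast
  qed
  then have "f t powr m \<le> (\<alpha> + \<beta>) * f t * t\<^sup>2 / 2" using f0 by simp
  moreover have "f t powr m = f t powr (m - 1) * f t"
    using ft by (simp add: powr_diff)
  ultimately have "f t powr (m - 1) * f t \<le> (\<alpha> + \<beta>) / 2 * t\<^sup>2 * f t" by (simp add: mult_ac)
  then have *: "f t powr (m - 1) \<le> (\<alpha> + \<beta>) / 2 * t\<^sup>2" using ft by simp
  have "f x powr (m - 1) \<le> f t powr (m - 1)"
    using max[of x] fx x p_gt_1 p_less_m by (intro powr_mono2) auto
  also note *
  also have "(\<alpha> + \<beta>) / 2 * t\<^sup>2 \<le> (\<alpha> + \<beta>) / 2 * x\<^sup>2"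
    using t t0 alpha_pos beta_pos by (intro mult_left_mono power_mono) auto
  finally show ?thesis .
qed

lemma continuous_on_weighted_w:
  assumes f0: "f 0 = 0" and e: "- 2 < e"
  shows "continuous_on {0..} (\<lambda>x. x powr e * f x powr m)"
proof (rule continuous_on_dominated_at_0)
  have "continuous_on {0<..} (\<lambda>x::real. x powr e)"
    by (rule continuous_on_powr'[OF continuous_on_id continuous_on_const]) auto
  moreover have "continuous_on {0<..} (\<lambda>x. f x powr m)"
    by (rule continuous_on_subset[OF continuous_on_f_powr]) (use p_gt_1 p_less_m in auto)
  ultimately show "continuous_on {0<..} (\<lambda>x. x powr e * f x powr m)"
    by (rule continuous_on_mult)
  let ?b = "\<lambda>x. (\<alpha> + \<beta>) / 2 * x powr (e + 2) * f x"
  show "continuous_on {0..} ?b"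
    using e by (intro continuous_on_mult continuous_on_const continuous_on_x_powr cont_f) auto
  show "?b 0 = 0" by simp
  fix x :: real assume x: "0 \<le> x"
  show "\<bar>x powr e * f x powr m\<bar> \<le> ?b x"
  proof (cases "x = 0 \<or> f x = 0")
    case False
    then have pos: "0 < x" "0 < f x" using x nonneg[of x] by auto
    have "x powr e * f x powr m = x powr e * f x * f x powr (m - 1)"
      using pos by (simp add: powr_diff)
    also have "\<dots> \<le> x powr e * f x * ((\<alpha> + \<beta>) / 2 * x\<^sup>2)"
      using pos by (intro mult_left_mono self_similar_bound f0) auto
    also have "\<dots> = ?b x"
      using pos by (simp add: powr_add)
    finally show ?thesis by simp
  qed auto
qed

section \<open>Profiles vanishing at the origin have no interface\<close>

text \<open>
  The functional \<open>?G\<close> collects the total derivatives that arise on multiplying the equation by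
  \<open>\<xi>\<^sup>k w' + C \<xi>\<^sup>k\<^sup>-\<^sup>1 w\<close>. What is left of its derivative is \<open>?D\<close>: a term in \<open>w'\<^sup>2\<close>, a term in \<open>w\<^sup>2\<close> that is
  nonpositive because \<open>k < 1\<close>, the friction, and a term in \<open>f\<^sup>m\<^sup>+\<^sup>1\<close>. Hypothesis \<open>gradient\<close> lets the
  friction absorb the first of these by means of the growth bound \<open>f\<^sup>m\<^sup>-\<^sup>1 \<le> (\<alpha> + \<beta>) \<xi>\<^sup>2 / 2\<close>, and
  \<open>potential\<close> makes the last one strictly negative.
\<close>

lemma pohozaev_obstruction:
  fixes k :: real
  defines "C \<equiv> m / (m + p) * (k + \<sigma>)"
  assumes k: "0 < k" "k < 1"
    and gradient: "(\<alpha> + \<beta>) / 2 * m * (k / 2 + C) \<le> \<beta>"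
    and potential: "\<alpha> * C + \<beta> * C * k / (m + 1) < \<alpha> * m * k / (m + 1)"
    and f0: "f 0 = 0" and \<eta>: "0 < \<eta>" "f \<eta> = 0"
    and pos: "\<And>x. 0 < x \<Longrightarrow> x < \<eta> \<Longrightarrow> 0 < f x"
  shows False
proof -
  let ?w = "\<lambda>x. f x powr m"
  let ?G = "\<lambda>x. x powr k * (dw x)\<^sup>2 / 2 + C * (x powr (k - 1) * ?w x) * dw x
     - C * (k - 1) / 2 * ((x powr (k - 2) * ?w x) * ?w x)
     - (\<alpha> * m - \<beta> * C) / (m + 1) * (x powr k * f x powr (m + 1))
     + m / (m + p) * (x powr (k + \<sigma>) * f x powr (m + p))"
  have C: "0 < C" using p_gt_1 p_less_m sigma_pos k by (simp add: C_def)
  have "?G \<eta> < ?G 0"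
  proof (rule DERIV_neg_imp_decreasing_open[where f = ?G])
    show "0 < \<eta>" by (rule \<eta>)
    have "continuous_on {0..} ?G"
      using f0 k p_gt_1 p_less_m sigma_pos
      by (intro continuous_on_add continuous_on_diff continuous_on_mult continuous_on_divide
          continuous_on_power continuous_on_const continuous_on_weighted_w continuous_on_x_powr
          continuous_on_f_powr cont_dw) auto
    then show "continuous_on {0..\<eta>} ?G"
      by (rule continuous_on_subset) auto
    fix x assume x: "0 < x" "x < \<eta>"
    \<comment> \<open>Every power that occurs is a monomial in the following quantities, so that the identity for
      the derivative becomes a rational one.\<close>
    define f1 where "f1 = deriv f x"
    define P where "P = x powr k"
    define F where "F = f x powr (m - 1)"
    define S where "S = x powr \<sigma>"
    define Q where "Q = f x powr p"
    define y where "y = f x"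
    have y: "0 < y" using pos x by (simp add: y_def)
    have gt: "0 < P" "0 < F" using x pos[OF x] by (auto simp: P_def F_def)
    have dwx: "dw x = m * F * f1"
      using dw_eq[of x] x pos by (simp add: F_def f1_def)
    have w: "?w x = F * y"
      using y by (simp add: F_def y_def powr_diff)
    define w2 where "w2 = \<alpha> * y - \<beta> * x * f1 - S * Q"
    have dG: "(?G has_real_derivative
       (k * (P / x) * (dw x)\<^sup>2 / 2 + P * dw x * w2)
       + (C * ((k - 1) * (P / x\<^sup>2) * (F * y) + P / x * dw x) * dw x + C * (P / x * (F * y)) * w2)
       - C * (k - 1) / 2 * (((k - 2) * (P / x ^ 3) * (F * y) + P / x\<^sup>2 * dw x) * (F * y)
            + P / x\<^sup>2 * (F * y) * dw x)
       - (\<alpha> * m - \<beta> * C) / (m + 1) * (k * (P / x) * (F * y\<^sup>2) + P * ((m + 1) * (F * y * f1)))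
       + m / (m + p) * ((k + \<sigma>) * (P * S / x) * (F * y * Q) + P * S * ((m + p) * (F * Q * f1)))) (at x)"
    proof -
      have xk: "((\<lambda>x. x powr k) has_real_derivative k * (P / x)) (at x)"
        using has_real_derivative_powr[OF x(1), of k] x by (simp add: P_def powr_diff)
      have xk1: "((\<lambda>x. x powr (k - 1)) has_real_derivative (k - 1) * (P / x\<^sup>2)) (at x)"
        using has_real_derivative_powr[OF x(1), of "k - 1"] x
        by (simp add: P_def powr_diff power2_eq_square)
      have xk2: "((\<lambda>x. x powr (k - 2)) has_real_derivative (k - 2) * (P / x ^ 3)) (at x)"
        using has_real_derivative_powr[OF x(1), of "k - 2"] x
        by (simp add: P_def powr_diff power2_eq_square power3_eq_cube)
      have xks: "((\<lambda>x. x powr (k + \<sigma>)) has_real_derivative (k + \<sigma>) * (P * S / x)) (at x)"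
        using has_real_derivative_powr[OF x(1), of "k + \<sigma>"] x
        by (simp add: P_def S_def powr_diff powr_add)
      note df = f_deriv[OF x(1) pos[OF x], folded f1_def]
      have fm1: "((\<lambda>x. f x powr (m + 1)) has_real_derivative (m + 1) * (F * y * f1)) (at x)"
        by (rule DERIV_cong[OF DERIV_fun_powr[OF df pos[OF x]]])
          (use y in \<open>simp add: F_def y_def powr_diff\<close>)
      have fmp: "((\<lambda>x. f x powr (m + p)) has_real_derivative (m + p) * (F * Q * f1)) (at x)"
        by (rule DERIV_cong[OF DERIV_fun_powr[OF df pos[OF x]]])
          (use y in \<open>simp add: F_def Q_def y_def powr_diff powr_add\<close>)
      have ddw: "(dw has_real_derivative w2) (at x)"
        using dw_deriv[OF x(1) pos[OF x]] by (simp add: w2_def y_def f1_def S_def Q_def)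
      have at_x: "x powr (k - 1) = P / x" "x powr (k - 2) = P / x\<^sup>2" "x powr (k + \<sigma>) = P * S"
          "f x powr (m + 1) = F * y\<^sup>2" "f x powr (m + p) = F * y * Q" "x powr k = P"
        using x y by (simp_all add: P_def S_def F_def y_def Q_def powr_diff powr_add power2_eq_square)
      show ?thesis
        by (rule DERIV_cong, (rule xk xk1 xk2 xks fm1 fmp ddw w_deriv_at[OF x(1)] DERIV_add DERIV_diff
            DERIV_cmult DERIV_mult DERIV_cdivide DERIV_power)+)
          (simp only: at_x w, simp add: power2_eq_square add_divide_distrib algebra_simps)
    qed
    \<comment> \<open>The terms with \<open>\<alpha> f w'\<close> cancel, and so do those with the reaction \<open>S * Q\<close>; the latter is what
      fixes the value of \<open>C\<close>.\<close>
    let ?D = "(k / 2 + C) * P / x * (m * F * f1)\<^sup>2 - C * (k - 1) * (k - 2) / 2 * P / x ^ 3 * (F * y)\<^sup>2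
       - \<beta> * x * P * m * F * f1\<^sup>2
       + P / x * F * y\<^sup>2 * (\<alpha> * C + \<beta> * C * k / (m + 1) - \<alpha> * m * k / (m + 1))"
    have "(?G has_real_derivative ?D) (at x)"
    proof (rule DERIV_cong[OF dG])
      have nz: "x \<noteq> 0" "m + 1 \<noteq> 0" "m + p \<noteq> 0" using x p_gt_1 p_less_m by auto
      show "(k * (P / x) * (dw x)\<^sup>2 / 2 + P * dw x * w2)
       + (C * ((k - 1) * (P / x\<^sup>2) * (F * y) + P / x * dw x) * dw x + C * (P / x * (F * y)) * w2)
       - C * (k - 1) / 2 * (((k - 2) * (P / x ^ 3) * (F * y) + P / x\<^sup>2 * dw x) * (F * y)
            + P / x\<^sup>2 * (F * y) * dw x)
       - (\<alpha> * m - \<beta> * C) / (m + 1) * (k * (P / x) * (F * y\<^sup>2) + P * ((m + 1) * (F * y * f1)))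
       + m / (m + p) * ((k + \<sigma>) * (P * S / x) * (F * y * Q) + P * S * ((m + p) * (F * Q * f1))) = ?D"
        using nz unfolding dwx w2_def C_def
        by (simp add: divide_simps power2_eq_square power3_eq_cube) (simp add: algebra_simps)
    qed
    moreover have "?D < 0"
    proof -
      have "(k / 2 + C) * m * F \<le> (k / 2 + C) * m * ((\<alpha> + \<beta>) / 2 * x\<^sup>2)"
        using k C p_gt_1 p_less_m x self_similar_bound[OF f0, of x]
        by (intro mult_left_mono) (auto simp: F_def)
      also have "\<dots> = (\<alpha> + \<beta>) / 2 * m * (k / 2 + C) * x\<^sup>2" by simp
      also have "\<dots> \<le> \<beta> * x\<^sup>2" by (rule mult_right_mono[OF gradient]) simp
      finally have "P / x * m * F * f1\<^sup>2 * ((k / 2 + C) * m * F) \<le> P / x * m * F * f1\<^sup>2 * (\<beta> * x\<^sup>2)"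
        using gt x p_gt_1 p_less_m by (intro mult_left_mono) auto
      then have 1: "(k / 2 + C) * P / x * (m * F * f1)\<^sup>2 \<le> \<beta> * x * P * m * F * f1\<^sup>2"
        using x by (simp add: field_simps power2_eq_square)
      have 2: "0 \<le> C * (k - 1) * (k - 2) / 2 * P / x ^ 3 * (F * y)\<^sup>2"
      proof -
        have "0 \<le> (k - 1) * (k - 2)" using k by (intro mult_nonpos_nonpos) auto
        then have "0 \<le> C * ((k - 1) * (k - 2)) / 2 * P / x ^ 3 * (F * y)\<^sup>2"
          using C gt x by simp
        then show ?thesis by (simp only: mult.assoc)
      qed
      have 3: "P / x * F * y\<^sup>2 * (\<alpha> * C + \<beta> * C * k / (m + 1) - \<alpha> * m * k / (m + 1)) < 0"
        using potential gt x y by (intro mult_pos_neg) auto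
      show ?thesis using 1 2 3 by linarith
    qed
    ultimately show "\<exists>D. (?G has_real_derivative D) (at x) \<and> D < 0" by blast
  qed
  moreover have "?G \<eta> = 0" "?G 0 = 0"
    using \<eta> f0 dw_0 dw_eq_0_at_zero[of \<eta>] by auto
  ultimately show False by simp
qed

end

text \<open>
  Both requirements only involve the ratio \<open>\<alpha> / \<beta> = (\<sigma> + 2) / (m - p)\<close>, which lies between
  \<open>2 / (m - p)\<close> and \<open>3 / (m - p)\<close> when \<open>\<sigma> \<le> 1\<close>. The first one holds for all small \<open>k\<close>, as \<open>C \<le> 2 k\<close>.
  Cleared of denominators the second one reads \<open>\<sigma> \<alpha> (m + 1) + \<beta> k (k + \<sigma>) < \<alpha> k (p - 1)\<close>: each
  summand on the left is made at most half of the right-hand side, the first by taking \<open>\<sigma>\<close> small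
  relative to \<open>k\<close>, the second by taking \<open>k\<close> small.
\<close>

lemma pohozaev_weight_exists:
  fixes m p :: real
  assumes "1 < p" "p < m"
  shows "\<exists>k \<sigma>\<^sub>0. 0 < k \<and> k < 1 \<and> 0 < \<sigma>\<^sub>0 \<and> (\<forall>\<sigma>. 0 < \<sigma> \<longrightarrow> \<sigma> < \<sigma>\<^sub>0 \<longrightarrow>
      (alpha m p \<sigma> + beta m p \<sigma>) / 2 * m * (k / 2 + m / (m + p) * (k + \<sigma>)) \<le> beta m p \<sigma> \<and>
      alpha m p \<sigma> * (m / (m + p) * (k + \<sigma>)) + beta m p \<sigma> * (m / (m + p) * (k + \<sigma>)) * k / (m + 1)
        < alpha m p \<sigma> * m * k / (m + 1))"
proof -
  define R where "R = 1 + 3 / (m - p)"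
  define k where "k = min (1 / 2) (min ((p - 1) / (2 * (m - p))) (4 / (5 * m * R)))"
  define \<sigma>\<^sub>0 where "\<sigma>\<^sub>0 = min k (k * (p - 1) / (2 * (m + 1)))"
  have R: "0 < R" using assms by (simp add: R_def add_pos_pos)
  have k: "0 < k" using assms R by (simp add: k_def)
  have k1: "k \<le> 1 / 2" and k2: "k \<le> (p - 1) / (2 * (m - p))" and k3: "k \<le> 4 / (5 * m * R)"
    unfolding k_def by linarith+
  have \<sigma>\<^sub>0: "0 < \<sigma>\<^sub>0" using assms k by (simp add: \<sigma>\<^sub>0_def)
  have coeff: "(alpha m p \<sigma> + beta m p \<sigma>) / 2 * m * (k / 2 + m / (m + p) * (k + \<sigma>)) \<le> beta m p \<sigma> \<and>
      alpha m p \<sigma> * (m / (m + p) * (k + \<sigma>)) + beta m p \<sigma> * (m / (m + p) * (k + \<sigma>)) * k / (m + 1)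
        < alpha m p \<sigma> * m * k / (m + 1)"
    if \<sigma>: "0 < \<sigma>" "\<sigma> < \<sigma>\<^sub>0" for \<sigma>
  proof -
    let ?a = "alpha m p \<sigma>" and ?b = "beta m p \<sigma>"
    have den: "0 < 2 * (p - 1) + \<sigma> * (m - 1)"
      using assms \<sigma> by (intro add_pos_pos) auto
    have a: "0 < ?a" and b: "0 < ?b"
      using den assms \<sigma> by (auto simp: alpha_def beta_def)
    have ab: "?a * (m - p) = ?b * (\<sigma> + 2)"
      by (simp add: alpha_def beta_def)
    have s1: "\<sigma> \<le> k" and s2: "\<sigma> < k * (p - 1) / (2 * (m + 1))"
      using \<sigma>(2) unfolding \<sigma>\<^sub>0_def by linarith+
    have "?b * (\<sigma> + 2) \<le> ?b * 3" using b s1 k1 by (intro mult_left_mono) auto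
    then have "?a * (m - p) \<le> ?b * 3" using ab by simp
    then have "?a \<le> ?b * 3 / (m - p)" using assms by (simp add: field_simps)
    then have abR: "?a + ?b \<le> ?b * R" by (simp add: R_def algebra_simps)
    have "m / (m + p) * (k + \<sigma>) \<le> 1 * (k + k)"
      using assms k \<sigma> s1 by (intro mult_mono) auto
    then have "k / 2 + m / (m + p) * (k + \<sigma>) \<le> k / 2 + 1 * (k + k)"
      by (rule add_left_mono)
    also have "\<dots> = 5 / 2 * k" by simp
    also have "\<dots> \<le> 5 / 2 * (4 / (5 * m * R))" using k3 by (rule mult_left_mono) simp
    also have "\<dots> = 2 / (m * R)" by simp
    finally have C: "k / 2 + m / (m + p) * (k + \<sigma>) \<le> 2 / (m * R)" .
    have "(?a + ?b) / 2 * m * (k / 2 + m / (m + p) * (k + \<sigma>)) \<le> ?b * R / 2 * m * (2 / (m * R))"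
      using abR C a b assms k \<sigma> R by (intro mult_mono) auto
    also have "\<dots> = ?b" using R assms by simp
    finally have 1: "(?a + ?b) / 2 * m * (k / 2 + m / (m + p) * (k + \<sigma>)) \<le> ?b" .
    have "\<sigma> * (m + 1) < k * (p - 1) / 2"
      using s2 assms by (simp add: field_simps)
    then have t1: "?a * (\<sigma> * (m + 1)) < ?a * (k * (p - 1) / 2)"
      using a by (rule mult_strict_left_mono)
    have "?b * 2 \<le> ?b * (\<sigma> + 2)" using b \<sigma> by simp
    then have ba: "?b * 2 \<le> ?a * (m - p)" using ab by simp
    have "?b * (k + \<sigma>) \<le> ?b * (2 * k)" using b s1 by simp
    also have "\<dots> \<le> ?a * (m - p) * k" using mult_right_mono[OF ba, of k] k by (simp add: mult_ac)
    also have "\<dots> \<le> ?a * (m - p) * ((p - 1) / (2 * (m - p)))"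
      using a assms k2 by (intro mult_left_mono) auto
    also have "\<dots> = ?a * (p - 1) / 2"
    proof -
      have "?a * q * ((p - 1) / (2 * q)) = ?a * (p - 1) / 2" if "q \<noteq> 0" for q :: real
        using that by simp
      from this[of "m - p"] show ?thesis using assms by simp
    qed
    finally have "?b * (k + \<sigma>) * k \<le> ?a * (p - 1) / 2 * k"
      using k by (intro mult_right_mono) auto
    with t1 have t: "(k + \<sigma>) * (?a * (m + 1) + ?b * k) < ?a * k * (m + p)"
      by (simp add: algebra_simps)
    have mp: "0 < m + p" "0 < m + 1" "0 < m" using assms by auto
    have "?a * (m / (m + p) * (k + \<sigma>)) + ?b * (m / (m + p) * (k + \<sigma>)) * k / (m + 1)
      = m / ((m + p) * (m + 1)) * ((k + \<sigma>) * (?a * (m + 1) + ?b * k))"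
    proof -
      have "a * (m / u * s) + b * (m / u * s) * k / v = m / (u * v) * (s * (a * v + b * k))"
        if "u \<noteq> 0" "v \<noteq> 0" for a b u v s :: real
        using that by (simp add: field_simps)
      from this[of "m + p" "m + 1"] show ?thesis using mp by simp
    qed
    also have "\<dots> < m / ((m + p) * (m + 1)) * (?a * k * (m + p))"
      using t mp by (intro mult_strict_left_mono) auto
    also have "\<dots> = ?a * m * k / (m + 1)"
    proof -
      have "m / (u * v) * (a * k * u) = a * m * k / v" if "u \<noteq> 0" "v \<noteq> 0" for a u v :: real
        using that by simp
      from this[of "m + p" "m + 1"] show ?thesis using mp by simp
    qed
    finally show ?thesis using 1 by blast
  qed
  have "k < 1" using k1 by simp
  with k \<sigma>\<^sub>0 coeff show ?thesis by blast
qed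

section \<open>The self-similar solution solves the differential equation\<close>

lemma filterlim_abs_at_right_0: "filterlim (\<lambda>h::real. \<bar>h\<bar>) (at_right 0) (at 0)"
proof -
  have "((\<lambda>h::real. \<bar>h\<bar>) \<longlongrightarrow> 0) (at 0)"
    by (rule tendsto_rabs_zero) (rule tendsto_ident_at)
  then show ?thesis
    by (auto simp: filterlim_at eventually_at_filter)
qed

lemma DERIV_even_extension_at_0:
  fixes g :: "real \<Rightarrow> real"
  assumes "(g has_real_derivative 0) (at 0 within {0..})"
  shows "((\<lambda>y. g \<bar>y\<bar>) has_real_derivative 0) (at 0)"
proof -
  have "((\<lambda>h. (g h - g 0) / h) \<longlongrightarrow> 0) (at_right 0)"
    using assms by (simp add: has_field_derivative_iff at_within_Ici_at_right)
  then have "((\<lambda>h. (g \<bar>h\<bar> - g 0) / \<bar>h\<bar>) \<longlongrightarrow> 0) (at 0)"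
    by (rule filterlim_compose[OF _ filterlim_abs_at_right_0])
  then have "((\<lambda>h. (g \<bar>h\<bar> - g 0) / h) \<longlongrightarrow> 0) (at 0)"
    by (rule tendsto_rabs_zero_cancel[OF tendsto_cong[THEN iffD1, rotated, OF tendsto_rabs_zero]])
      (simp add: abs_divide)
  then show ?thesis
    by (simp add: has_field_derivative_iff)
qed

lemma DERIV_abs_nonzero:
  fixes y :: real
  assumes "y \<noteq> 0"
  shows "((\<lambda>z. \<bar>z\<bar>) has_real_derivative sgn y) (at y)"
proof (rule has_field_derivative_transform_within_open)
  show "((\<lambda>z. sgn y * z) has_real_derivative sgn y) (at y)"
    using DERIV_cmult_Id by simp
  show "open {z. 0 < y * z}" by (intro open_Collect_less continuous_intros)
  show "y \<in> {z. 0 < y * z}" using assms by (auto simp: zero_less_mult_iff)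
qed (auto simp: zero_less_mult_iff)

lemma DERIV_even_extension:
  fixes g :: "real \<Rightarrow> real"
  assumes "y \<noteq> 0" "(g has_real_derivative D) (at \<bar>y\<bar>)"
  shows "((\<lambda>y. g \<bar>y\<bar>) has_real_derivative sgn y * D) (at y)"
  using DERIV_chain2[OF assms(2) DERIV_abs_nonzero[OF assms(1)]]
  by (simp add: mult.commute)

lemma DERIV_odd_extension:
  fixes g :: "real \<Rightarrow> real"
  assumes "y \<noteq> 0" "(g has_real_derivative D) (at \<bar>y\<bar>)"
  shows "((\<lambda>y. sgn y * g \<bar>y\<bar>) has_real_derivative D) (at y)"
proof -
  have "((\<lambda>z. sgn y * g \<bar>z\<bar>) has_real_derivative D) (at y)"
    using DERIV_cmult[OF DERIV_even_extension[OF assms], of "sgn y"] assms(1)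
    by (simp add: sgn_if split: if_splits)
  then show ?thesis
  proof (rule has_field_derivative_transform_within_open)
    show "open {z. 0 < y * z}" by (intro open_Collect_less continuous_intros)
    show "y \<in> {z. 0 < y * z}" using assms(1) by (auto simp: zero_less_mult_iff)
  qed (auto simp: zero_less_mult_iff sgn_if)
qed

context profile
begin

text \<open>
  The two identities that make the self-similar ansatz compatible with diffusion and with reaction.
\<close>

lemma alpha_scaling: "\<alpha> * (m - 1) = 2 * \<beta> + 1" "\<alpha> * (p - 1) + \<beta> * \<sigma> = 1"
proof -
  define N where "N = 2 * (p - 1) + \<sigma> * (m - 1)"
  have N: "0 < N" using denominator_pos by (simp add: N_def)
  have a: "\<alpha> = (\<sigma> + 2) / N" and b: "\<beta> = (m - p) / N"
    by (simp_all add: alpha_def beta_def N_def)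
  have e1: "(\<sigma> + 2) * (m - 1) = 2 * (m - p) + N"
    and e2: "(\<sigma> + 2) * (p - 1) + (m - p) * \<sigma> = N"
    by (simp_all add: N_def algebra_simps)
  have "\<alpha> * (m - 1) = ((\<sigma> + 2) * (m - 1)) / N" by (simp add: a)
  also have "\<dots> = 2 * \<beta> + 1" unfolding e1 b using N by (simp add: add_divide_distrib)
  finally show "\<alpha> * (m - 1) = 2 * \<beta> + 1" .
  have "\<alpha> * (p - 1) + \<beta> * \<sigma> = ((\<sigma> + 2) * (p - 1) + (m - p) * \<sigma>) / N"
    by (simp add: a b flip: add_divide_distrib)
  also have "\<dots> = 1" unfolding e2 using N by simp
  finally show "\<alpha> * (p - 1) + \<beta> * \<sigma> = 1" .
qed

text \<open>
  The derivative of the even extension of \<open>f\<^sup>m\<close> to the real line.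
\<close>

definition dw_odd :: "real \<Rightarrow> real" where
  "dw_odd y = sgn y * dw \<bar>y\<bar>"

lemma DERIV_w_even: "((\<lambda>y. f \<bar>y\<bar> powr m) has_real_derivative dw_odd y) (at y)"
proof (cases "y = 0")
  case True
  then show ?thesis
    using DERIV_even_extension_at_0[of "\<lambda>y. f y powr m"] w_deriv[of 0] dw_0
    by (simp add: dw_odd_def)
next
  case False
  then show ?thesis
    using DERIV_even_extension[of y "\<lambda>y. f y powr m"] w_deriv_at[of "\<bar>y\<bar>"]
    by (simp add: dw_odd_def)
qed

lemma continuous_dw_odd: "continuous_on UNIV dw_odd"
proof -
  have "continuous_on {0..} dw_odd"
    by (rule continuous_on_eq[OF cont_dw]) (auto simp: dw_odd_def sgn_if dw_0)
  moreover have "continuous_on {..0} (\<lambda>y. - dw (- y))"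
    by (intro continuous_intros continuous_on_compose2[OF cont_dw]) auto
  then have "continuous_on {..0} dw_odd"
    by (rule continuous_on_eq) (auto simp: dw_odd_def sgn_if dw_0)
  ultimately have "continuous_on ({0..} \<union> {..0}) dw_odd"
    by (intro continuous_on_closed_Un) auto
  moreover have "{0..} \<union> {..0} = (UNIV :: real set)" by auto
  ultimately show ?thesis by simp
qed

text \<open>
  At the origin the equation is not assumed, and the formula is read with \<open>0 powr \<sigma> = 0\<close> and the
  product \<open>0 * deriv f 0 = 0\<close>, whatever \<open>deriv f 0\<close> is. There \<open>w''(\<xi>) \<longlongrightarrow> \<alpha> f(0)\<close> as \<open>\<xi> \<longlongrightarrow> 0\<close>,
  because \<open>\<xi> f' = \<xi> w' / (m f\<^sup>m\<^sup>-\<^sup>1) \<longlongrightarrow> 0\<close>, and l'Hopital's rule transfers this limit to the difference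
  quotient \<open>w'(\<xi>) / \<xi>\<close>.
\<close>

lemma DERIV_dw_odd:
  assumes fy: "0 < f \<bar>y\<bar>"
  shows "(dw_odd has_real_derivative
    \<alpha> * f \<bar>y\<bar> - \<beta> * \<bar>y\<bar> * deriv f \<bar>y\<bar> - \<bar>y\<bar> powr \<sigma> * f \<bar>y\<bar> powr p) (at y)"
proof (cases "y = 0")
  case False
  then show ?thesis
    using DERIV_odd_extension[of y dw] dw_deriv[of "\<bar>y\<bar>"] fy
    by (simp add: dw_odd_def[abs_def])
next
  case True
  then have f0: "0 < f 0" using fy by simp
  have flim: "(f \<longlongrightarrow> f 0) (at_right 0)"
    using cont_f by (auto simp: continuous_on_def at_within_Ici_at_right dest: bspec[of _ _ 0])
  have dwlim: "(dw \<longlongrightarrow> 0) (at_right 0)"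
    using cont_dw dw_0 by (auto simp: continuous_on_def at_within_Ici_at_right dest: bspec[of _ _ 0])
  have pos: "eventually (\<lambda>x. 0 < x \<and> 0 < f x) (at_right 0)"
    using order_tendstoD(1)[OF flim f0] eventually_at_right_less[of 0]
    by eventually_elim simp
  have "((\<lambda>x. \<alpha> * f x - \<beta> * (x * (dw x / (m * f x powr (m - 1)))) - x powr \<sigma> * f x powr p)
      \<longlongrightarrow> \<alpha> * f 0 - \<beta> * (0 * (0 / (m * f 0 powr (m - 1)))) - 0 powr \<sigma> * f 0 powr p) (at_right 0)"
    using f0 p_gt_1 p_less_m sigma_pos
    by (intro tendsto_intros flim dwlim) (auto simp: eventually_at_filter)
  then have "((\<lambda>x. \<alpha> * f x - \<beta> * (x * (dw x / (m * f x powr (m - 1)))) - x powr \<sigma> * f x powr p)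
      \<longlongrightarrow> \<alpha> * f 0) (at_right 0)" by simp
  moreover have "eventually (\<lambda>x. \<alpha> * f x - \<beta> * (x * (dw x / (m * f x powr (m - 1)))) - x powr \<sigma> * f x powr p
      = (\<alpha> * f x - \<beta> * x * deriv f x - x powr \<sigma> * f x powr p) / 1) (at_right 0)"
    using pos by eventually_elim (use p_gt_1 p_less_m in \<open>simp add: dw_eq\<close>)
  ultimately have lim: "((\<lambda>x. (\<alpha> * f x - \<beta> * x * deriv f x - x powr \<sigma> * f x powr p) / 1)
      \<longlongrightarrow> \<alpha> * f 0) (at_right 0)"
    by (rule Lim_transform_eventually)
  have "((\<lambda>x. dw x / x) \<longlongrightarrow> \<alpha> * f 0) (at_right 0)"
  proof (rule lhopital_right[OF dwlim _ _ _ _ _ lim])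
    show "eventually (\<lambda>x. (dw has_real_derivative
        \<alpha> * f x - \<beta> * x * deriv f x - x powr \<sigma> * f x powr p) (at x)) (at_right 0)"
      using pos by eventually_elim (simp add: dw_deriv)
  qed (auto simp: eventually_at_filter tendsto_ident_at)
  then have "((\<lambda>h. dw \<bar>h\<bar> / \<bar>h\<bar>) \<longlongrightarrow> \<alpha> * f 0) (at 0)"
    by (rule filterlim_compose[OF _ filterlim_abs_at_right_0])
  moreover have "eventually (\<lambda>h. dw \<bar>h\<bar> / \<bar>h\<bar> = (dw_odd h - dw_odd 0) / h) (at 0)"
    by (auto simp: eventually_at_filter dw_odd_def sgn_if)
  ultimately have "((\<lambda>h. (dw_odd h - dw_odd 0) / h) \<longlongrightarrow> \<alpha> * f 0) (at 0)"
    by (rule Lim_transform_eventually)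
  then show ?thesis
    using True by (simp add: has_field_derivative_iff)
qed

lemma self_similar_powr_m:
  assumes "t < T"
  shows "self_similar m p \<sigma> T f y t powr m =
    (T - t) powr (- (\<alpha> * m)) * f \<bar>y * (T - t) powr \<beta>\<bar> powr m"
  using nonneg[of "\<bar>y * (T - t) powr \<beta>\<bar>"]
  by (simp add: self_similar_def powr_mult powr_powr abs_mult)

lemma DERIV_self_similar_powr_m:
  assumes "t < T"
  shows "((\<lambda>y. self_similar m p \<sigma> T f y t powr m) has_real_derivative
    (T - t) powr (- (\<alpha> * m)) * (dw_odd (y * (T - t) powr \<beta>) * (T - t) powr \<beta>)) (at y)"
proof -
  have "((\<lambda>y. y * (T - t) powr \<beta>) has_real_derivative (T - t) powr \<beta>) (at y)"
    by (auto intro!: derivative_eq_intros)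
  from DERIV_cmult[OF DERIV_chain2[OF DERIV_w_even this]] show ?thesis
    unfolding self_similar_powr_m[OF assms] .
qed

lemma DERIV_self_similar_time:
  assumes t: "t < T" and pos: "0 < f (\<bar>x\<bar> * (T - t) powr \<beta>)"
  defines "r \<equiv> \<bar>x\<bar> * (T - t) powr \<beta>"
  shows "((\<lambda>s. self_similar m p \<sigma> T f x s) has_real_derivative
    (T - t) powr (- \<alpha> - 1) * (\<alpha> * f r - \<beta> * r * deriv f r)) (at t)"
proof -
  have pw: "((\<lambda>s. (T - s) powr a) has_real_derivative - a * (T - t) powr (a - 1)) (at t)" for a
    using DERIV_fun_powr[of "\<lambda>s. T - s" "-1" t a] t by (auto intro!: derivative_eq_intros)
  show ?thesis
  proof (cases "x = 0")
    case True
    then show ?thesis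
      using DERIV_cmult_right[OF pw[of "- \<alpha>"], of "f 0"]
      by (simp add: self_similar_def r_def mult_ac)
  next
    case False
    then have r: "0 < r" using t by (simp add: r_def)
    have "((\<lambda>s. f (\<bar>x\<bar> * (T - s) powr \<beta>)) has_real_derivative
        deriv f r * (\<bar>x\<bar> * (- \<beta> * (T - t) powr (\<beta> - 1)))) (at t)"
      using DERIV_chain2[OF _ DERIV_cmult[OF pw[of \<beta>], of "\<bar>x\<bar>"]] f_deriv[OF r] pos
      by (simp add: r_def)
    then have product: "((\<lambda>s. self_similar m p \<sigma> T f x s) has_real_derivative
        - (- \<alpha>) * (T - t) powr (- \<alpha> - 1) * f r + deriv f r * (\<bar>x\<bar> * (- \<beta> * (T - t) powr (\<beta> - 1)))
          * (T - t) powr (- \<alpha>)) (at t)"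
      unfolding self_similar_def r_def by (rule DERIV_mult[OF pw])
    define d where "d = T - t"
    have "d \<noteq> 0" using t by (simp add: d_def)
    then show ?thesis
      using product unfolding d_def[symmetric]
      by (elim DERIV_cong) (simp add: r_def powr_diff field_simps flip: d_def)
  qed
qed

lemma pde_solution_self_similar:
  "pde_solution m p \<sigma> T (self_similar m p \<sigma> T f)"
  unfolding pde_solution_def
proof (intro conjI allI ballI impI)
  fix x t assume "t \<in> {0..<T}"
  then show "0 \<le> self_similar m p \<sigma> T f x t"
    by (simp add: self_similar_def nonneg)
next
  show "continuous_on (UNIV \<times> {0..<T}) (\<lambda>(x, t). self_similar m p \<sigma> T f x t)"
    unfolding self_similar_def case_prod_beta
    by (intro continuous_on_mult continuous_on_compose2[OF cont_f] continuous_on_powr'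
        continuous_on_diff continuous_on_const continuous_on_rabs continuous_on_fst
        continuous_on_snd continuous_on_id) auto
next
  fix t assume "t \<in> {0..<T}"
  then have t: "t < T" by simp
  show "C1_on UNIV (\<lambda>x. self_similar m p \<sigma> T f x t powr m)"
    unfolding C1_on_def using DERIV_self_similar_powr_m[OF t]
    by (intro exI[of _ "\<lambda>y. (T - t) powr (- (\<alpha> * m)) * (dw_odd (y * (T - t) powr \<beta>) * (T - t) powr \<beta>)"]
        conjI continuous_intros continuous_on_compose2[OF continuous_dw_odd]) auto
next
  fix x t assume "t \<in> {0<..<T}" and u: "0 < self_similar m p \<sigma> T f x t"
  then have t: "t < T" by simp
  define L where "L = (T - t) powr \<beta>"
  have L: "0 < L" using t by (simp add: L_def)
  define r where "r = \<bar>x\<bar> * L"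
  have rx: "\<bar>x * L\<bar> = r" using L by (simp add: r_def abs_mult)
  have fr: "0 < f r"
    using u t by (simp add: self_similar_def r_def L_def zero_less_mult_iff)
  let ?u = "self_similar m p \<sigma> T f"
  let ?w2 = "\<alpha> * f r - \<beta> * r * deriv f r - r powr \<sigma> * f r powr p"
  have "((\<lambda>y. dw_odd (y * L)) has_real_derivative ?w2 * L) (at x)"
    by (rule DERIV_chain2[where g = "\<lambda>y. y * L"]) (use DERIV_dw_odd[of "x * L"] fr rx in \<open>auto intro!: derivative_eq_intros\<close>)
  then have "((\<lambda>y. (T - t) powr (- (\<alpha> * m)) * (dw_odd (y * L) * L)) has_real_derivative
      (T - t) powr (- (\<alpha> * m)) * (?w2 * L * L)) (at x)"
    by (intro DERIV_cmult DERIV_cmult_right)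
  moreover have "deriv (\<lambda>y. ?u y t powr m) = (\<lambda>y. (T - t) powr (- (\<alpha> * m)) * (dw_odd (y * L) * L))"
    using DERIV_self_similar_powr_m[OF t] by (auto simp: L_def intro!: DERIV_imp_deriv)
  ultimately have second: "(deriv (\<lambda>y. ?u y t powr m) has_real_derivative
      (T - t) powr (- (\<alpha> * m)) * (?w2 * L * L)) (at x)" by simp
  have time: "((\<lambda>s. ?u x s) has_real_derivative
      (T - t) powr (- \<alpha> - 1) * (\<alpha> * f r - \<beta> * r * deriv f r)) (at t)"
    using DERIV_self_similar_time[OF t, of x] fr by (simp add: r_def L_def)
  have e1: "(T - t) powr (- (\<alpha> * m)) * L * L = (T - t) powr (- \<alpha> - 1)"
  proof -
    have "- (\<alpha> * m) + \<beta> + \<beta> = - \<alpha> - 1"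
      using alpha_scaling(1) by (simp add: algebra_simps)
    then show ?thesis by (simp add: L_def flip: powr_add)
  qed
  have e2: "(T - t) powr (- \<alpha> - 1) * r powr \<sigma> = \<bar>x\<bar> powr \<sigma> * (T - t) powr (- (\<alpha> * p))"
  proof -
    have "- \<alpha> - 1 + \<beta> * \<sigma> = - (\<alpha> * p)"
      using alpha_scaling(2) by (simp add: algebra_simps)
    then have "(T - t) powr (- \<alpha> - 1) * L powr \<sigma> = (T - t) powr (- (\<alpha> * p))"
      by (simp add: L_def powr_powr flip: powr_add)
    then show ?thesis using L by (simp add: r_def powr_mult)
  qed
  have up: "?u x t powr p = (T - t) powr (- (\<alpha> * p)) * f r powr p"
    using fr by (simp add: self_similar_def r_def L_def powr_mult powr_powr)
  have "(T - t) powr (- \<alpha> - 1) * (\<alpha> * f r - \<beta> * r * deriv f r)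
      = (T - t) powr (- \<alpha> - 1) * ?w2 + (T - t) powr (- \<alpha> - 1) * r powr \<sigma> * f r powr p"
    by (simp add: algebra_simps)
  also have "\<dots> = (T - t) powr (- (\<alpha> * m)) * (?w2 * L * L) + \<bar>x\<bar> powr \<sigma> * ?u x t powr p"
    unfolding e2 up by (simp add: mult_ac flip: e1)
  finally show "\<exists>ut w2. ((\<lambda>s. ?u x s) has_real_derivative ut) (at t) \<and>
      (deriv (\<lambda>y. ?u y t powr m) has_real_derivative w2) (at x) \<and>
      ut = w2 + \<bar>x\<bar> powr \<sigma> * ?u x t powr p"
    using time second by blast
qed

end

section \<open>Global blow-up\<close>

text \<open>
  For a continuous function the set where the essential supremum is exceeded is open and null.
\<close>

lemma ereal_le_Linf_norm:
  assumes g: "continuous_on UNIV g"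
  shows "ereal \<bar>g x\<bar> \<le> Linf_norm g"
proof (rule ccontr)
  let ?U = "{y. Linf_norm g < ereal \<bar>g y\<bar>}"
  assume "\<not> ereal \<bar>g x\<bar> \<le> Linf_norm g"
  then have "x \<in> ?U" by simp
  have U: "open ?U"
    using g by (intro open_Collect_less continuous_intros) auto
  have "AE y in lborel. ereal \<bar>g y\<bar> \<le> Linf_norm g"
    unfolding Linf_norm_def by (rule esssup_AE)
  then have "AE y in lborel. y \<notin> ?U"
    by eventually_elim simp
  then have "?U \<in> null_sets lborel"
    using U by (subst AE_iff_null_sets) auto
  then have "negligible ?U"
    by (simp add: negligible_iff_null_sets null_sets_completionI)
  then show False
    using open_not_negligible[OF U] \<open>x \<in> ?U\<close> by blast
qed

context profile
begin

lemma self_similar_at_top: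
  assumes f0: "0 < f 0"
  shows "filterlim (\<lambda>t. self_similar m p \<sigma> T f x t) at_top (at_left T)"
proof -
  have "((\<lambda>t. T - t) \<longlongrightarrow> T - T) (at_left T)"
    by (intro tendsto_intros)
  then have gap: "filterlim (\<lambda>t. T - t) (at_right 0) (at_left T)"
    by (auto simp: filterlim_at eventually_at_filter)
  have "filterlim (\<lambda>s. s powr (- \<alpha>)) at_top (at_right 0)"
    using alpha_pos by real_asymp
  then have amplitude: "filterlim (\<lambda>t. (T - t) powr (- \<alpha>)) at_top (at_left T)"
    by (rule filterlim_compose[OF _ gap])
  have "((\<lambda>s. f (\<bar>x\<bar> * s powr \<beta>)) \<longlongrightarrow> f (\<bar>x\<bar> * 0 powr \<beta>)) (at 0 within {0..})"
  proof -
    have "continuous_on {0..} (\<lambda>s. f (\<bar>x\<bar> * s powr \<beta>))"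
      by (intro continuous_on_mult continuous_on_compose2[OF cont_f] continuous_on_const
          continuous_on_x_powr beta_pos) auto
    then show ?thesis by (auto simp: continuous_on_def dest: bspec[of _ _ 0])
  qed
  then have "((\<lambda>s. f (\<bar>x\<bar> * s powr \<beta>)) \<longlongrightarrow> f 0) (at_right 0)"
    by (simp add: at_within_Ici_at_right)
  then have "((\<lambda>t. f (\<bar>x\<bar> * (T - t) powr \<beta>)) \<longlongrightarrow> f 0) (at_left T)"
    by (rule filterlim_compose[OF _ gap])
  from filterlim_at_top_mult_tendsto_pos[OF this f0 amplitude] show ?thesis
    by (simp add: self_similar_def)
qed

lemma self_similar_blows_up_globally:
  assumes f0: "0 < f 0" and T: "0 < T" and bound: "\<And>x. 0 \<le> x \<Longrightarrow> f x \<le> M"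
  shows "blows_up_globally (self_similar m p \<sigma> T f) T"
proof -
  let ?u = "self_similar m p \<sigma> T f"
  have cont: "continuous_on UNIV (\<lambda>x. ?u x t)" if "t < T" for t
    unfolding self_similar_def
    by (intro continuous_intros continuous_on_compose2[OF cont_f]) auto
  have "in_Linf (\<lambda>x. ?u x t)" if "t < T" for t
  proof -
    have meas: "(\<lambda>x. ?u x t) \<in> borel_measurable lborel"
      using borel_measurable_continuous_onI[OF cont[OF that]] by simp
    have "\<bar>?u x t\<bar> \<le> (T - t) powr (- \<alpha>) * M" for x
      using bound[of "\<bar>x\<bar> * (T - t) powr \<beta>"] nonneg[of "\<bar>x\<bar> * (T - t) powr \<beta>"]
      by (simp add: self_similar_def abs_mult mult_left_mono)
    then have "Linf_norm (\<lambda>x. ?u x t) \<le> ereal ((T - t) powr (- \<alpha>) * M)"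
      unfolding Linf_norm_def using meas by (intro esssup_I) auto
    then have "Linf_norm (\<lambda>x. ?u x t) < \<infinity>"
      using le_less_trans by fastforce
    with meas show ?thesis by (simp add: in_Linf_def)
  qed
  moreover have "((\<lambda>t. Linf_norm (\<lambda>x. ?u x t)) \<longlongrightarrow> \<infinity>) (at_left T)"
    unfolding tendsto_PInfty
  proof
    fix B :: real
    have "eventually (\<lambda>t. B < ?u 0 t) (at_left T)"
      using self_similar_at_top[OF f0, of T 0] by (simp add: filterlim_at_top_dense)
    moreover have "eventually (\<lambda>t. t < T) (at_left T)"
      by (simp add: eventually_at_filter)
    ultimately show "eventually (\<lambda>t. ereal B < Linf_norm (\<lambda>x. ?u x t)) (at_left T)"
    proof eventually_elim
      case (elim t)
      have "ereal B < ereal \<bar>?u 0 t\<bar>" using elim by simp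
      also have "\<dots> \<le> Linf_norm (\<lambda>x. ?u x t)"
        by (rule ereal_le_Linf_norm[OF cont[OF elim(2)]])
      finally show ?case .
    qed
  qed
  moreover have "blow_up_set ?u T = UNIV"
  proof -
    define \<tau> where "\<tau> k = T - T / (real k + 2)" for k
    have \<tau>: "\<tau> k \<in> {0<..<T}" for k
      using T by (simp add: \<tau>_def field_simps add_pos_nonneg)
    have "\<tau> \<longlonglongrightarrow> T"
      unfolding \<tau>_def by real_asymp
    moreover from this have "filterlim \<tau> (at_left T) sequentially"
      using \<tau> by (auto simp: filterlim_at intro!: always_eventually less_imp_neq)
    then have "filterlim (\<lambda>k. \<bar>?u x (\<tau> k)\<bar>) at_top sequentially" for x
      by (intro filterlim_compose[OF filterlim_abs_real] filterlim_compose[OF self_similar_at_top[OF f0]])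
    ultimately have "x \<in> blow_up_set ?u T" for x
      unfolding blow_up_set_def mem_Collect_eq
      using \<tau> by (intro exI[of _ "\<lambda>_. x"] exI[of _ \<tau>]) auto
    then show ?thesis by blast
  qed
  ultimately show ?thesis
    using T by (auto simp: blows_up_globally_def blow_up_time_def)
qed

end

theorem theorem1p3:
  fixes m p :: real
  assumes "1 < p" and "p < m"
  shows "\<exists>\<sigma>\<^sub>0>0. \<forall>\<sigma>\<in>{0<..<\<sigma>\<^sub>0}. \<forall>f.
           good_profile_with_interface m p \<sigma> f \<longrightarrow>
             type_P1 f \<and>
             (\<forall>T>0. pde_solution m p \<sigma> T (self_similar m p \<sigma> T f) \<and>
                    blows_up_globally (self_similar m p \<sigma> T f) T)"
proof -
  obtain k \<sigma>\<^sub>0 where k: "0 < k" "k < 1" and \<sigma>\<^sub>0: "0 < \<sigma>\<^sub>0" and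
    gradient: "\<And>\<sigma>. 0 < \<sigma> \<Longrightarrow> \<sigma> < \<sigma>\<^sub>0 \<Longrightarrow>
      (alpha m p \<sigma> + beta m p \<sigma>) / 2 * m * (k / 2 + m / (m + p) * (k + \<sigma>)) \<le> beta m p \<sigma>" and
    potential: "\<And>\<sigma>. 0 < \<sigma> \<Longrightarrow> \<sigma> < \<sigma>\<^sub>0 \<Longrightarrow>
      alpha m p \<sigma> * (m / (m + p) * (k + \<sigma>)) + beta m p \<sigma> * (m / (m + p) * (k + \<sigma>)) * k / (m + 1)
        < alpha m p \<sigma> * m * k / (m + 1)"
    using pohozaev_weight_exists[OF assms] by blast
  show ?thesis
  proof (intro exI[of _ \<sigma>\<^sub>0] conjI ballI allI impI \<sigma>\<^sub>0)
    fix \<sigma> f assume "\<sigma> \<in> {0<..<\<sigma>\<^sub>0}" and "good_profile_with_interface m p \<sigma> f"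
    then have \<sigma>: "0 < \<sigma>" "\<sigma> < \<sigma>\<^sub>0" and good: "good_profile m p \<sigma> f"
      and "\<exists>\<eta>. interface_at m f \<eta>"
      by (auto simp: good_profile_with_interface_def)
    then obtain \<eta> where \<eta>: "interface_at m f \<eta>" by blast
    obtain dw where "profile m p \<sigma> f dw"
      using good_profile_imp_profile[OF assms \<sigma>(1) good] .
    then interpret profile m p \<sigma> f dw .
    note sup = interface_support[OF \<eta>]
    have "f 0 \<noteq> 0"
      using pohozaev_obstruction[OF k gradient[OF \<sigma>] potential[OF \<sigma>] _ sup(1-3)] by blast
    then show P1: "type_P1 f"
      using good by (auto simp: good_profile_def type_P2_def)
    fix T :: real assume T: "0 < T"
    show "pde_solution m p \<sigma> T (self_similar m p \<sigma> T f)"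
      by (rule pde_solution_self_similar)
    obtain M where "\<forall>x\<ge>0. f x \<le> M"
      using bounded_of_interface[OF \<eta>] by blast
    with P1 T show "blows_up_globally (self_similar m p \<sigma> T f) T"
      by (intro self_similar_blows_up_globally) (auto simp: type_P1_def)
  qed
qed

end
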